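(* Let $p\in\mathbf{Z}_{>0}$. (i) The fiber of the conumerator above $p$ is $$\mathrm{con}^{-1}(p)=\bigl\{J(p/q)\;:\; q\in\mathbf{Z}_{>0},\ \gcd(p,q)=1\bigr\}.$$ (ii) The number of orbits of the map $x\mapsto \frac{1}{1+x}$ inside $\mathrm{con}^{-1}(p)$ equals $\phi(p)$, where $\phi$ is Euler's totient function.
   Context: The conumerator $\mathrm{con}:\mathbf{Q}_{>0}\to\mathbf{Z}_{>0}$ is the unique function with $\mathrm{con}(1)=1$ satisfying, for all $x\in\mathbf{Q}_{>0}$, $\mathrm{con}(1+x)=\mathrm{con}(x)+\mathrm{con}(1/x)$ and $\mathrm{con}\left(\frac{1}{1+x}\right)=\mathrm{con}(x)$; in particular each fiber of $\mathrm{con}$ is mapped into itself by $x\mapsto\frac1{1+x}$. The function $J$ ("Jimm") is $J:\mathbf{Q}_{>0}\to\mathbf{Q}_{>0}$, $J(x):=\mathrm{con}(x)/\mathrm{con}(1/x)$. Orbits of the map $T(x)=\frac{1}{1+x}$ are the classes of the equivalence relation in which $x\sim y$ iff $y=T^k(x)$ or $x=T^k(y)$ for some integer $k\ge 0$ ($T$ is injective on $\mathbf{Q}_{>0}$). *)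

theory Defs
  imports Complex_Main "HOL-Number_Theory.Totient"
begin

(* The positive rationals are rendered as the positive elements of type rat; the value 0 on
   nonpositive arguments is a dummy, needed only to make the total function unique. *)
definition is_conumerator :: "(rat \<Rightarrow> nat) \<Rightarrow> bool" where
  "is_conumerator f \<longleftrightarrow>
     (\<forall>x>0. f x > 0) \<and> (\<forall>x\<le>0. f x = 0) \<and>
     f 1 = 1 \<and>
     (\<forall>x>0. f (1 + x) = f x + f (1 / x)) \<and>
     (\<forall>x>0. f (1 / (1 + x)) = f x)"

definition con :: "rat \<Rightarrow> nat" where
  "con = (THE f. is_conumerator f)"

definition Jimm :: "rat \<Rightarrow> rat" where
  "Jimm x = of_nat (con x) / of_nat (con (1 / x))"

definition con_fiber :: "nat \<Rightarrow> rat set" where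
  "con_fiber p = {x. x > 0 \<and> con x = p}"

definition orbit_map :: "rat \<Rightarrow> rat" where
  "orbit_map x = 1 / (1 + x)"

definition orbit_rel :: "(rat \<times> rat) set" where
  "orbit_rel = {(x, y). x > 0 \<and> y > 0 \<and> (\<exists>k. y = (orbit_map ^^ k) x \<or> x = (orbit_map ^^ k) y)}"


text \<open>Existence and uniqueness of the conumerator, so that the definite description above
  is meaningful. Existence uses subtractive Euclidean recursion on a numerator and a denominator,
  which need not be coprime.\<close>

function cn :: "nat \<Rightarrow> nat \<Rightarrow> nat" where
  "cn a b =
     (if a = 0 \<or> b = 0 then 0
      else if a = b then 1
      else if b < a then cn (a - b) b + cn b (a - b)
      else cn (b - a) a)"
  by pat_completeness auto
termination by (relation "measure (\<lambda>(a, b). a + b)") auto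

declare cn.simps [simp del]

lemma cn_0: "a = 0 \<or> b = 0 \<Longrightarrow> cn a b = 0"
  by (subst cn.simps) simp

lemma cn_eq: "a > 0 \<Longrightarrow> cn a a = 1"
  by (subst cn.simps) simp

lemma cn_gt: "0 < b \<Longrightarrow> b < a \<Longrightarrow> cn a b = cn (a - b) b + cn b (a - b)"
  by (subst cn.simps) simp

lemma cn_lt: "0 < a \<Longrightarrow> a < b \<Longrightarrow> cn a b = cn (b - a) a"
  by (subst cn.simps) simp

lemma cn_scale: "k > 0 \<Longrightarrow> cn (k * a) (k * b) = cn a b"
proof (induction a b rule: cn.induct)
  case (1 a b)
  consider "a = 0 \<or> b = 0" | "a > 0" "a = b" | "b > 0" "b < a" | "a > 0" "a < b"
    by linarith
  then show ?case
  proof cases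
    case 1
    then show ?thesis by (auto simp: cn_0)
  next
    case 2
    then show ?thesis using \<open>k > 0\<close> by (simp add: cn_eq)
  next
    case 3
    have e: "cn (k * (a - b)) (k * b) = cn (a - b) b" "cn (k * b) (k * (a - b)) = cn b (a - b)"
      using 3 1 by auto
    show ?thesis
      using 3 \<open>k > 0\<close> e by (simp add: cn_gt right_diff_distrib')
  next
    case 4
    have e: "cn (k * (b - a)) (k * a) = cn (b - a) a"
      using 4 1 by auto
    show ?thesis
      using 4 \<open>k > 0\<close> e by (simp add: cn_lt right_diff_distrib')
  qed
qed

lemma cn_pos: "a > 0 \<Longrightarrow> b > 0 \<Longrightarrow> cn a b > 0"
proof (induction a b rule: cn.induct)
  case (1 a b)
  then show ?case by (subst cn.simps) auto
qed

lemma rat_pos_cases: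
  fixes x :: rat
  assumes "x > 0"
  obtains a b :: nat where "a > 0" "b > 0" "x = of_nat a / of_nat b"
proof (cases x)
  case (Fract m n)
  have "m > 0" using assms Fract by (simp add: zero_less_Fract_iff)
  then show ?thesis
    using that[of "nat m" "nat n"] Fract by (simp add: Fract_of_int_quotient)
qed

lemma cn_cong:
  assumes "b > 0" "d > 0" "(of_nat a / of_nat b :: rat) = of_nat c / of_nat d"
  shows "cn a b = cn c d"
proof -
  have "(of_nat (a * d) :: rat) = of_nat (c * b)"
    using assms by (simp add: field_simps)
  then have e: "a * d = c * b"
    by (simp only: of_nat_eq_iff)
  have "cn a b = cn (d * a) (d * b)" using cn_scale assms(2) by simp
  also have "\<dots> = cn (b * c) (b * d)" using e by (simp add: mult.commute)
  also have "\<dots> = cn c d" using cn_scale assms(1) by simp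
  finally show ?thesis .
qed

definition cnq :: "rat \<Rightarrow> nat" where
  "cnq x = (if x \<le> 0 then 0
            else THE n. \<exists>a b. a > 0 \<and> b > 0 \<and> x = of_nat a / of_nat b \<and> n = cn a b)"

lemma cnq_frac:
  assumes "a > 0" "b > 0"
  shows "cnq (of_nat a / of_nat b) = cn a b"
proof -
  have "\<not> (of_nat a / of_nat b :: rat) \<le> 0"
    using assms by (simp add: not_le)
  moreover have "(THE n. \<exists>a' b'. a' > 0 \<and> b' > 0 \<and>
      (of_nat a / of_nat b :: rat) = of_nat a' / of_nat b' \<and> n = cn a' b') = cn a b"
  proof (rule the_equality)
    show "\<exists>a' b'. a' > 0 \<and> b' > 0 \<and>
        (of_nat a / of_nat b :: rat) = of_nat a' / of_nat b' \<and> cn a b = cn a' b'"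
      using assms by (intro exI[of _ a] exI[of _ b]) simp
  next
    fix n
    assume "\<exists>a' b'. a' > 0 \<and> b' > 0 \<and>
        (of_nat a / of_nat b :: rat) = of_nat a' / of_nat b' \<and> n = cn a' b'"
    then obtain a' b' where "b' > 0" "(of_nat a / of_nat b :: rat) = of_nat a' / of_nat b'"
      "n = cn a' b'"
      by (elim exE conjE)
    then show "n = cn a b"
      using cn_cong[OF assms(2)] by metis
  qed
  ultimately show ?thesis by (simp add: cnq_def)
qed

lemma is_conumerator_cnq: "is_conumerator cnq"
  unfolding is_conumerator_def
proof (intro conjI allI impI)
  show "cnq x = 0" if "x \<le> 0" for x
    using that by (simp add: cnq_def)
  show "cnq 1 = 1"
    using cnq_frac[of 1 1] by (simp add: cn_eq)
next
  fix x :: rat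
  assume "x > 0"
  then obtain a b :: nat where ab: "a > 0" "b > 0" "x = of_nat a / of_nat b"
    by (rule rat_pos_cases)
  show "cnq x > 0"
    using ab by (simp add: cnq_frac cn_pos)
  have 1: "1 + x = of_nat (a + b) / of_nat b" "1 / x = of_nat b / of_nat a"
    "1 / (1 + x) = of_nat b / of_nat (a + b)"
    unfolding ab(3) using ab(1,2) by (simp_all add: field_simps)
  show "cnq (1 + x) = cnq x + cnq (1 / x)"
    unfolding 1 unfolding ab(3) using ab(1,2)
    by (subst (1 2 3) cnq_frac) (simp_all add: cn_gt)
  show "cnq (1 / (1 + x)) = cnq x"
    unfolding 1(3) unfolding ab(3) using ab(1,2)
    by (subst (1 2) cnq_frac) (simp_all add: cn_lt)
qed

lemma is_conumerator_unique:
  assumes "is_conumerator f" "is_conumerator g"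
  shows "f = g"
proof -
  have "a > 0 \<Longrightarrow> b > 0 \<Longrightarrow>
      f (of_nat a / of_nat b) = g (of_nat a / of_nat b)" for a b
  proof (induction a b rule: cn.induct)
    case (1 a b)
    consider "a = b" | "b < a" | "a < b" by linarith
    then show ?case
    proof cases
      case 1
      then show ?thesis using \<open>b > 0\<close> assms by (simp add: is_conumerator_def)
    next
      case 2
      define x :: rat where "x = of_nat (a - b) / of_nat b"
      have x: "x > 0" "of_nat a / of_nat b = 1 + x" "1 / x = of_nat b / of_nat (a - b)"
        using 2 \<open>b > 0\<close> by (simp_all add: x_def of_nat_diff field_simps)
      have "f x = g x" "f (1 / x) = g (1 / x)"
        using 1 2 unfolding x(3) unfolding x_def by auto
      then show ?thesis
        using assms x(1) unfolding x(2) by (simp add: is_conumerator_def)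
    next
      case 3
      define x :: rat where "x = of_nat (b - a) / of_nat a"
      have x: "x > 0" "of_nat a / of_nat b = 1 / (1 + x)"
        using 3 \<open>a > 0\<close> by (simp_all add: x_def of_nat_diff field_simps)
      have "f x = g x"
        using 1 3 unfolding x_def by auto
      then show ?thesis
        using assms x(1) unfolding x(2) by (simp add: is_conumerator_def)
    qed
  qed
  then have "f x = g x" if "x > 0" for x
    using rat_pos_cases[OF that] by metis
  moreover have "f x = g x" if "x \<le> 0" for x
    using assms that by (simp add: is_conumerator_def)
  ultimately show ?thesis
    by (intro ext) (metis not_le)
qed

lemma is_conumerator_con: "is_conumerator con"
  unfolding con_def
  by (rule theI[of is_conumerator, OF is_conumerator_cnq])
    (rule is_conumerator_unique[OF _ is_conumerator_cnq])

lemma con_pos: "x > 0 \<Longrightarrow> con x > 0"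
  and con_one: "con 1 = 1"
  and con_one_plus: "x > 0 \<Longrightarrow> con (1 + x) = con x + con (1 / x)"
  and con_inverse_one_plus: "x > 0 \<Longrightarrow> con (1 / (1 + x)) = con x"
  using is_conumerator_con by (auto simp: is_conumerator_def)

lemma orbit_map_pos: "x > 0 \<Longrightarrow> orbit_map x > 0"
  by (simp add: orbit_map_def)

lemma orbit_map_inj: "x > 0 \<Longrightarrow> y > 0 \<Longrightarrow> orbit_map x = orbit_map y \<Longrightarrow> x = y"
  by (simp add: orbit_map_def)

lemma funpow_orbit_map_pos: "x > 0 \<Longrightarrow> (orbit_map ^^ k) x > 0"
  by (induction k) (auto intro: orbit_map_pos)

lemma funpow_orbit_map_inj: "x > 0 \<Longrightarrow> y > 0 \<Longrightarrow> (orbit_map ^^ k) x = (orbit_map ^^ k) y \<Longrightarrow> x = y"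
  by (induction k) (auto dest: orbit_map_inj[OF funpow_orbit_map_pos funpow_orbit_map_pos])

lemma con_funpow_orbit_map: "x > 0 \<Longrightarrow> con ((orbit_map ^^ k) x) = con x"
proof (induction k)
  case (Suc k)
  have "(orbit_map ^^ Suc k) x = 1 / (1 + (orbit_map ^^ k) x)"
    using orbit_map_def by simp
  then show ?case
    using Suc con_inverse_one_plus[OF funpow_orbit_map_pos[of x k]] by simp
qed simp

lemma orbit_rel_con: "(x, y) \<in> orbit_rel \<Longrightarrow> con x = con y"
  by (auto simp: orbit_rel_def con_funpow_orbit_map)

lemma equiv_orbit_rel: "equiv {0<..} orbit_rel"
proof (rule equivI)
  show "orbit_rel \<subseteq> {0<..} \<times> {0<..}"
    by (auto simp: orbit_rel_def)
  show "refl_on {0<..} orbit_rel"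
    by (auto simp: refl_on_def orbit_rel_def intro: exI[of _ 0])
  show "sym orbit_rel"
    by (auto simp: sym_def orbit_rel_def)
  have common: "(x, z) \<in> orbit_rel"
    if "x > 0" "z > 0" "(orbit_map ^^ j) x = (orbit_map ^^ k) z" for x z j k
  proof (cases "j \<le> k")
    case True
    then have "(orbit_map ^^ j) x = (orbit_map ^^ j) ((orbit_map ^^ (k - j)) z)"
      using that(3) by (metis comp_apply funpow_add le_add_diff_inverse)
    then have "x = (orbit_map ^^ (k - j)) z"
      using funpow_orbit_map_inj funpow_orbit_map_pos that(1,2) by blast
    then show ?thesis using that by (auto simp: orbit_rel_def)
  next
    case False
    then have "(orbit_map ^^ k) ((orbit_map ^^ (j - k)) x) = (orbit_map ^^ k) z"
      using that(3) by (metis comp_apply funpow_add le_add_diff_inverse nat_le_linear)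
    then have "(orbit_map ^^ (j - k)) x = z"
      using funpow_orbit_map_inj funpow_orbit_map_pos that(1,2) by blast
    then show ?thesis using that by (auto simp: orbit_rel_def)
  qed
  have meet: "\<exists>j k. (orbit_map ^^ j) x = (orbit_map ^^ k) y" if "(x, y) \<in> orbit_rel" for x y
  proof -
    obtain k where "y = (orbit_map ^^ k) x \<or> x = (orbit_map ^^ k) y"
      using \<open>(x, y) \<in> orbit_rel\<close> by (auto simp: orbit_rel_def)
    then have "(orbit_map ^^ k) x = (orbit_map ^^ 0) y \<or> (orbit_map ^^ 0) x = (orbit_map ^^ k) y"
      by auto
    then show ?thesis by blast
  qed
  show "trans orbit_rel"
  proof (rule transI)
    fix x y z
    assume xy: "(x, y) \<in> orbit_rel" and yz: "(y, z) \<in> orbit_rel"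
    obtain a b where ab: "(orbit_map ^^ a) x = (orbit_map ^^ b) y" using meet[OF xy] by blast
    obtain c d where cd: "(orbit_map ^^ c) y = (orbit_map ^^ d) z" using meet[OF yz] by blast
    have "(orbit_map ^^ (c + a)) x = (orbit_map ^^ c) ((orbit_map ^^ b) y)" using ab by (simp add: funpow_add)
    also have "\<dots> = (orbit_map ^^ b) ((orbit_map ^^ c) y)"
      by (metis add.commute comp_apply funpow_add)
    also have "\<dots> = (orbit_map ^^ (b + d)) z" using cd by (simp add: funpow_add)
    finally show "(x, z) \<in> orbit_rel"
      using xy yz by (intro common) (auto simp: orbit_rel_def)
  qed
qed

end

(*  J is an involution, and con x is the reduced numerator of J x because con x and con (1 / x)
    are coprime. Hence x \<mapsto> con (1 / x) is a bijection from the fiber above p onto the positive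
    integers q coprime to p, with inverse q \<mapsto> J (p / q). Under this bijection
    x \<mapsto> 1 / (1 + x) becomes q \<mapsto> q + p, so the orbits are the residue classes
    coprime to p.  *)
theory Submission
  imports Defs
begin

text \<open>Subtractive Euclid on a fraction a / b, by induction on a + b. If a < b, then a / b = 1
  / (1 + (b - a) / a), so \<open>one_plus\<close> followed by \<open>inverse\<close> reaches it.
  These two generators match the functional equations of \<open>con\<close>.\<close>

lemma rat_pos_induct [consumes 1, case_names one one_plus inverse]:
  fixes x :: rat
  assumes "x > 0"
    and one: "P 1"
    and one_plus: "\<And>x. x > 0 \<Longrightarrow> P x \<Longrightarrow> P (1 + x)"
    and inverse: "\<And>x. x > 0 \<Longrightarrow> P x \<Longrightarrow> P (1 / x)"
  shows "P x"
proof -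
  have "P (of_nat a / of_nat b)" if "a > 0" "b > 0" for a b :: nat
    using that
  proof (induction "a + b" arbitrary: a b rule: less_induct)
    case less
    consider "a = b" | "b < a" | "a < b" by linarith
    then show ?case
    proof cases
      case 1
      then show ?thesis using one less.prems by simp
    next
      case 2
      have "P (of_nat (a - b) / of_nat b)" using 2 less.prems by (intro less.hyps) simp_all
      then have "P (1 + of_nat (a - b) / of_nat b)" using 2 less.prems by (intro one_plus) simp_all
      moreover have "1 + of_nat (a - b) / of_nat b = (of_nat a / of_nat b :: rat)"
        using 2 less.prems by (simp add: of_nat_diff field_simps)
      ultimately show ?thesis by simp
    next
      case 3
      have "P (of_nat (b - a) / of_nat a)" using 3 less.prems by (intro less.hyps) simp_all
      then have "P (1 / (1 + of_nat (b - a) / of_nat a))"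
        using 3 less.prems by (intro inverse one_plus) (simp_all add: add_pos_pos)
      moreover have "1 / (1 + of_nat (b - a) / of_nat a) = (of_nat a / of_nat b :: rat)"
        using 3 less.prems by (simp add: of_nat_diff field_simps)
      ultimately show ?thesis by simp
    qed
  qed
  then show ?thesis using rat_pos_cases[OF \<open>x > 0\<close>] by metis
qed

text \<open>Passing from x to 1 + x turns the pair (m, n) of values of \<open>con\<close> at x and 1
  / x into (m + n, m), which has the same gcd. Inversion swaps the pair.\<close>

lemma coprime_con: "x > 0 \<Longrightarrow> coprime (con x) (con (1 / x))"
proof (induction rule: rat_pos_induct)
  case (one_plus x)
  then have "coprime (con x) (con x + con (1 / x))"
    by (simp add: coprime_iff_gcd_eq_1)
  then show ?case
    unfolding con_one_plus[OF one_plus.hyps] con_inverse_one_plus[OF one_plus.hyps]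
    by (subst coprime_commute)
qed (simp_all add: con_one coprime_commute)

lemma Jimm_pos: "x > 0 \<Longrightarrow> Jimm x > 0"
  by (simp add: Jimm_def con_pos)

lemma Jimm_inverse: "Jimm (1 / x) = 1 / Jimm x"
  by (simp add: Jimm_def)

lemma Jimm_one_plus: "x > 0 \<Longrightarrow> Jimm (1 + x) = 1 + 1 / Jimm x"
  using con_pos[of x] con_pos[of "1 / x"]
  by (simp add: Jimm_def con_one_plus con_inverse_one_plus field_simps)

lemma Jimm_Jimm: "x > 0 \<Longrightarrow> Jimm (Jimm x) = x"
proof (induction rule: rat_pos_induct)
  case one
  show ?case by (simp add: Jimm_def con_one)
next
  case (one_plus x)
  \<comment> \<open>\<open>Jimm_one_plus\<close> is used twice: at x, then at 1 /
    \<open>Jimm x\<close>. By \<open>Jimm_inverse\<close> the inner reciprocals cancel, leaving 1 +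
    \<open>Jimm (Jimm x)\<close>.\<close>
  then have "Jimm (Jimm (1 + x)) = 1 + 1 / Jimm (1 / Jimm x)"
    by (simp add: Jimm_one_plus Jimm_pos)
  then show ?case using one_plus by (simp only: Jimm_inverse) simp
next
  case (inverse x)
  then show ?case by (simp only: Jimm_inverse)
qed

lemma of_nat_quotient_eqD:
  fixes a b c d :: nat
  assumes "(of_nat a / of_nat b :: 'a::field_char_0) = of_nat c / of_nat d"
    and "coprime a b" "coprime c d" "b > 0" "d > 0"
  shows "a = c" "b = d"
proof -
  have "(of_nat (a * d) :: 'a) = of_nat (c * b)"
    using assms(1,4,5) by (simp add: field_simps)
  then have "a * d = c * b"
    by (simp only: of_nat_eq_iff)
  then show "a = c" "b = d"
    using coprime_crossproduct_nat[of a b c d] assms(2,3) by (simp_all add: ac_simps)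
qed

text \<open>For x = \<open>Jimm\<close> (p / q), the involution gives \<open>Jimm x\<close> = p / q.
  Both this fraction and the one defining \<open>Jimm x\<close> are reduced, so they agree
  termwise.\<close>

lemma con_Jimm_quotient:
  assumes "p > 0" "q > 0" "coprime p q"
  shows "con (Jimm (of_nat p / of_nat q)) = p" and "con (1 / Jimm (of_nat p / of_nat q)) = q"
proof -
  define x where "x = Jimm (of_nat p / of_nat q)"
  have "x > 0" using assms by (simp add: x_def Jimm_pos)
  have "of_nat (con x) / of_nat (con (1 / x)) = (of_nat p / of_nat q :: rat)"
    using Jimm_Jimm[of "of_nat p / of_nat q"] assms(1,2) unfolding x_def Jimm_def[of "Jimm _"] by simp
  from of_nat_quotient_eqD[OF this coprime_con[OF \<open>x > 0\<close>] assms(3)]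
  show "con (Jimm (of_nat p / of_nat q)) = p" and "con (1 / Jimm (of_nat p / of_nat q)) = q"
    using \<open>x > 0\<close> assms(2) con_pos[of "1 / x"] by (simp_all add: x_def)
qed

lemma con_fiber_eq:
  assumes "p > 0"
  shows "con_fiber p = {Jimm (of_nat p / of_nat q) | q :: nat. q > 0 \<and> coprime p q}"
proof (intro equalityI subsetI)
  fix x assume "x \<in> con_fiber p"
  then have "x > 0" "con x = p" by (auto simp: con_fiber_def)
  then have "x = Jimm (of_nat p / of_nat (con (1 / x)))"
    using Jimm_Jimm[of x] by (simp add: Jimm_def[of x])
  moreover have "con (1 / x) > 0" "coprime p (con (1 / x))"
    using \<open>x > 0\<close> \<open>con x = p\<close> coprime_con[of x] by (auto intro: con_pos)
  ultimately show "x \<in> {Jimm (of_nat p / of_nat q) | q :: nat. q > 0 \<and> coprime p q}" by blast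
next
  fix x :: rat assume "x \<in> {Jimm (of_nat p / of_nat q) | q :: nat. q > 0 \<and> coprime p q}"
  then show "x \<in> con_fiber p"
    using assms by (auto simp: con_fiber_def con_Jimm_quotient Jimm_pos)
qed

text \<open>Since 1 / \<open>orbit_map y\<close> = 1 + y, each step adds \<open>con y\<close> to the
  value at the reciprocal, and \<open>con y\<close> is constant along the orbit.\<close>

lemma con_inverse_funpow_orbit_map:
  "x > 0 \<Longrightarrow> con (1 / (orbit_map ^^ k) x) = con (1 / x) + k * con x"
proof (induction k)
  case (Suc k)
  define y where "y = (orbit_map ^^ k) x"
  have "y > 0" "con y = con x"
    using Suc.prems by (simp_all add: y_def funpow_orbit_map_pos con_funpow_orbit_map)
  moreover have "1 / (orbit_map ^^ Suc k) x = 1 + y"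
    by (simp add: y_def orbit_map_def)
  ultimately show ?case
    using Suc by (simp add: con_one_plus y_def)
qed simp

text \<open>The two values determine \<open>Jimm x\<close>, and an involution is injective.\<close>

lemma eq_if_con_eq:
  assumes "x > 0" "y > 0" "con x = con y" "con (1 / x) = con (1 / y)"
  shows "x = y"
  using Jimm_Jimm[of x] Jimm_Jimm[of y] assms by (simp add: Jimm_def[of x] Jimm_def[of y])

text \<open>Iterates shift \<open>con (1 / x)\<close> by multiples of \<open>con x\<close>.
  Conversely, if the residues agree, the quotient of the difference by \<open>con x\<close> is the
  number of iterations leading from the smaller value to the larger.\<close>

lemma orbit_rel_iff:
  "(x, y) \<in> orbit_rel \<longleftrightarrow>
     x > 0 \<and> y > 0 \<and> con x = con y \<and> con (1 / x) mod con x = con (1 / y) mod con y"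
proof
  assume "(x, y) \<in> orbit_rel"
  then show "x > 0 \<and> y > 0 \<and> con x = con y \<and> con (1 / x) mod con x = con (1 / y) mod con y"
    using orbit_rel_con[of x y]
    by (auto simp: orbit_rel_def con_inverse_funpow_orbit_map con_funpow_orbit_map)
next
  have *: "\<exists>k. y = (orbit_map ^^ k) x"
    if xy: "x > 0" "y > 0" "con x = con y" "con (1 / x) mod con x = con (1 / y) mod con y"
      and le: "con (1 / x) \<le> con (1 / y)" for x y
  proof -
    have "con x dvd con (1 / y) - con (1 / x)"
      using xy le by (metis mod_eq_dvd_iff_nat)
    then obtain k where "con (1 / y) = con (1 / x) + k * con x"
      using le by (metis dvdE le_add_diff_inverse mult.commute)
    then have "y = (orbit_map ^^ k) x"
      using xy by (intro eq_if_con_eq)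
        (simp_all add: con_inverse_funpow_orbit_map con_funpow_orbit_map funpow_orbit_map_pos)
    then show ?thesis ..
  qed
  assume "x > 0 \<and> y > 0 \<and> con x = con y \<and> con (1 / x) mod con x = con (1 / y) mod con y"
  then show "(x, y) \<in> orbit_rel"
    using *[of x y] *[of y x] by (cases "con (1 / x) \<le> con (1 / y)") (auto simp: orbit_rel_def)
qed

lemma card_con_fiber_orbits:
  assumes "p > 0"
  shows "card (con_fiber p // orbit_rel) = totient p"
proof -
  let ?J = "\<lambda>q::nat. Jimm (of_nat p / of_nat q)"
  have rel: "orbit_rel `` {?J q} = orbit_rel `` {?J r} \<longleftrightarrow> q mod p = r mod p"
    if "q > 0" "coprime p q" "r > 0" "coprime p r" for q r
  proof -
    have "orbit_rel `` {?J q} = orbit_rel `` {?J r} \<longleftrightarrow> (?J q, ?J r) \<in> orbit_rel"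
      using that assms by (intro eq_equiv_class_iff[OF equiv_orbit_rel]) (simp_all add: Jimm_pos)
    then show ?thesis
      using that assms by (simp add: orbit_rel_iff con_Jimm_quotient Jimm_pos)
  qed
  have "bij_betw (\<lambda>r. orbit_rel `` {?J r}) (totatives p) (con_fiber p // orbit_rel)"
    unfolding bij_betw_def
  proof (intro conjI inj_onI equalityI subsetI)
    fix q r
    assume qr: "q \<in> totatives p" "r \<in> totatives p" "orbit_rel `` {?J q} = orbit_rel `` {?J r}"
    then have "q mod p = r mod p"
      by (subst (asm) rel) (auto simp: totatives_def coprime_commute)
    moreover have "0 < q" "q \<le> p" "0 < r" "r \<le> p"
      using qr by (auto simp: totatives_def)
    ultimately show "q = r"
      \<comment> \<open>Totatives lie between 1 and p: those below p are their own residues, and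
        only p has residue 0.\<close>
      by (cases "q = p"; cases "r = p") auto
  next
    fix C assume "C \<in> (\<lambda>r. orbit_rel `` {?J r}) ` totatives p"
    then show "C \<in> con_fiber p // orbit_rel"
      by (auto simp: con_fiber_eq[OF assms] totatives_def coprime_commute intro!: quotientI)
  next
    fix C assume "C \<in> con_fiber p // orbit_rel"
    then obtain q where q: "q > 0" "coprime p q" "C = orbit_rel `` {?J q}"
      by (auto simp: con_fiber_eq[OF assms] elim!: quotientE)
    \<comment> \<open>Residue 0 is represented by p, as totatives are positive. As q is coprime to
      p, this occurs only for p = 1.\<close>
    define r where "r = (if q mod p = 0 then p else q mod p)"
    have r: "r mod p = q mod p" "0 < r" "r \<le> p"
      using assms by (auto simp: r_def intro: less_imp_le)
    have "coprime p r"
      using q(2) r(1) by (metis coprime_mod_right_iff assms gr_implies_not0)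
    then have "r \<in> totatives p" "C = orbit_rel `` {?J r}"
      using r q rel[of q r] by (auto simp: totatives_def coprime_commute)
    then show "C \<in> (\<lambda>r. orbit_rel `` {?J r}) ` totatives p" by blast
  qed
  then show ?thesis by (simp add: bij_betw_same_card totient_def)
qed

theorem lemma4:
  fixes p :: nat
  assumes "p > 0"
  shows "con_fiber p = {Jimm (of_nat p / of_nat q) | q :: nat. q > 0 \<and> coprime p q} \<and>
         card (con_fiber p // orbit_rel) = totient p"
  using con_fiber_eq[OF assms] card_con_fiber_orbits[OF assms] by blast

end
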